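(* Let $V$ be any vertex algebra and $W$ any $V$-module. If $V$ and $W$ are $C_2$-cofinite, i.e. $\dim V/C_2(V)<\infty$ and $\dim W/C_2(W)<\infty$, then $W$ is $C_n$-cofinite, i.e. $\dim W/C_n(W)<\infty$, for all $n\ge 2$.
   Context: Vector spaces are over $\mathbb{C}$. For a vertex algebra $V$ and a $V$-module $W$, write $v_n$ ($v\in V$, $n\in\mathbb{Z}$) for the modes of $v$ acting on $W$: $Y_W(v,x)=\sum_{n\in\mathbb{Z}}v_nx^{-n-1}$. For $n\ge 2$, $C_n(W)$ is the linear span of the vectors $v_{-n}w$ for $v\in V$, $w\in W$; $C_n(V)$ is the case $W=V$. *)

theory Defs
  imports Complex_Main "HOL-Library.Groups_Big_Fun"
begin

text \<open>
  The quotient of a complex vector space by a subspace \<open>U\<close>, with the cosets of \<open>U\<close> as its vectors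
  (so \<open>U\<close> itself is the zero vector). In \<open>coset_scale\<close>, adding \<open>U\<close> after scaling is only needed
  for the scalar \<open>0\<close>.
\<close>

definition coset :: "'a::ab_group_add set \<Rightarrow> 'a \<Rightarrow> 'a set" where
  "coset U x = {x + u | u. u \<in> U}"

definition coset_add :: "'a::ab_group_add set \<Rightarrow> 'a set \<Rightarrow> 'a set" where
  "coset_add A B = {a + b | a b. a \<in> A \<and> b \<in> B}"

definition coset_scale ::
  "(complex \<Rightarrow> 'a \<Rightarrow> 'a) \<Rightarrow> 'a::ab_group_add set \<Rightarrow> complex \<Rightarrow> 'a set \<Rightarrow> 'a set" where
  "coset_scale s U c A = {s c a + u | a u. a \<in> A \<and> u \<in> U}"

definition quotient_space :: "'a::ab_group_add set \<Rightarrow> 'a set set" where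
  "quotient_space U = range (coset U)"

inductive_set quotient_span ::
    "(complex \<Rightarrow> 'a \<Rightarrow> 'a) \<Rightarrow> 'a::ab_group_add set \<Rightarrow> 'a set set \<Rightarrow> 'a set set"
  for s :: "complex \<Rightarrow> 'a::ab_group_add \<Rightarrow> 'a" and U :: "'a set" and B :: "'a set set" where
  zero: "U \<in> quotient_span s U B"
| step: "A \<in> B \<Longrightarrow> X \<in> quotient_span s U B \<Longrightarrow>
           coset_add (coset_scale s U c A) X \<in> quotient_span s U B"

definition finite_dim_quotient :: "(complex \<Rightarrow> 'a \<Rightarrow> 'a) \<Rightarrow> 'a::ab_group_add set \<Rightarrow> bool" where
  "finite_dim_quotient s U \<longleftrightarrow>
     (\<exists>B. finite B \<and> B \<subseteq> quotient_space U \<and> quotient_span s U B = quotient_space U)"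

context vector_space
begin

lemma coset_eq_iff:
  assumes "subspace U"
  shows "coset U x = coset U y \<longleftrightarrow> x - y \<in> U"
proof
  assume "coset U x = coset U y"
  moreover have "x + 0 \<in> coset U x"
    unfolding coset_def using subspace_0[OF assms] by blast
  ultimately obtain u where "u \<in> U" "x = y + u" unfolding coset_def by force
  then show "x - y \<in> U" by simp
next
  assume d: "x - y \<in> U"
  have "x + u \<in> coset U y" if "u \<in> U" for u
    unfolding coset_def mem_Collect_eq
    by (rule exI[of _ "(x - y) + u"]) (simp add: subspace_add[OF assms d that])
  moreover have "y + u \<in> coset U x" if "u \<in> U" for u
    unfolding coset_def mem_Collect_eq
    by (rule exI[of _ "u - (x - y)"]) (simp add: subspace_diff[OF assms that d])
  ultimately show "coset U x = coset U y"
    unfolding coset_def by auto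
qed

end

lemma coset_add_coset:
  assumes "vector_space (s :: complex \<Rightarrow> 'a::ab_group_add \<Rightarrow> 'a)" "module.subspace s U"
  shows "coset_add (coset U x) (coset U y) = coset U (x + y)"
proof -
  interpret vector_space s by fact
  show ?thesis
  proof (intro equalityI subsetI)
    fix z assume "z \<in> coset_add (coset U x) (coset U y)"
    then obtain u v where "u \<in> U" "v \<in> U" "z = (x + u) + (y + v)"
      unfolding coset_add_def coset_def by auto
    then have "z = (x + y) + (u + v)" "u + v \<in> U"
      using subspace_add[OF assms(2)] by auto
    then show "z \<in> coset U (x + y)" unfolding coset_def by blast
  next
    fix z assume "z \<in> coset U (x + y)"
    then obtain u where u: "u \<in> U" "z = (x + y) + u" unfolding coset_def by auto
    have "x + u \<in> coset U x" "y + 0 \<in> coset U y"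
      unfolding coset_def using u(1) subspace_0[OF assms(2)] by blast+
    moreover have "z = (x + u) + (y + 0)" using u by simp
    ultimately show "z \<in> coset_add (coset U x) (coset U y)"
      unfolding coset_add_def by blast
  qed
qed

lemma coset_scale_coset:
  assumes "vector_space (s :: complex \<Rightarrow> 'a::ab_group_add \<Rightarrow> 'a)" "module.subspace s U"
  shows "coset_scale s U c (coset U x) = coset U (s c x)"
proof -
  interpret vector_space s by fact
  show ?thesis
  proof (intro equalityI subsetI)
    fix z assume "z \<in> coset_scale s U c (coset U x)"
    then obtain u v where uv: "u \<in> U" "v \<in> U" "z = s c (x + u) + v"
      unfolding coset_scale_def coset_def by auto
    then have "z = s c x + (s c u + v)" by (simp add: scale_right_distrib add.assoc)
    moreover have "s c u + v \<in> U"
      using uv subspace_add[OF assms(2)] subspace_scale[OF assms(2)] by blast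
    ultimately show "z \<in> coset U (s c x)" unfolding coset_def by blast
  next
    fix z assume "z \<in> coset U (s c x)"
    then obtain u where u: "u \<in> U" "z = s c x + u" unfolding coset_def by auto
    have "x + 0 \<in> coset U x"
      unfolding coset_def using subspace_0[OF assms(2)] by blast
    moreover have "z = s c (x + 0) + u" using u by simp
    ultimately show "z \<in> coset_scale s U c (coset U x)"
      unfolding coset_scale_def using u(1) by blast
  qed
qed

lemma quotient_span_coset_image:
  assumes "vector_space (s :: complex \<Rightarrow> 'a::ab_group_add \<Rightarrow> 'a)" "module.subspace s U"
  shows "quotient_span s U (coset U ` F) = coset U ` module.span s F"
proof -
  interpret vector_space s by fact
  note sub = assms(2)
  have U: "coset U 0 = U" unfolding coset_def by simp
  show ?thesis
  proof (intro equalityI subsetI)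
    fix X assume "X \<in> quotient_span s U (coset U ` F)"
    then show "X \<in> coset U ` span F"
    proof induction
      case zero
      show ?case using imageI[OF span_zero, of "coset U" F] by (simp only: U)
    next
      case (step A X c)
      then obtain a x where "a \<in> F" "A = coset U a" "x \<in> span F" "X = coset U x" by auto
      then have "s c a + x \<in> span F" by (simp add: span_add span_scale span_base)
      with \<open>A = coset U a\<close> \<open>X = coset U x\<close> show ?case
        by (simp add: coset_scale_coset[OF assms] coset_add_coset[OF assms])
    qed
  next
    fix X assume "X \<in> coset U ` span F"
    then obtain x where x: "x \<in> span F" "X = coset U x" by auto
    from x(1) have "coset U x \<in> quotient_span s U (coset U ` F)"
    proof (induction rule: span_induct_alt)
      case base
      show ?case by (simp only: U quotient_span.zero)
    next
      case (step c a y)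
      then show ?case
        using quotient_span.step[of "coset U a" "coset U ` F" "coset U y" s U c]
        by (simp add: coset_scale_coset[OF assms] coset_add_coset[OF assms])
    qed
    then show "X \<in> quotient_span s U (coset U ` F)" using x by simp
  qed
qed

lemma finite_dim_quotient_iff:
  assumes "vector_space (s :: complex \<Rightarrow> 'a::ab_group_add \<Rightarrow> 'a)" "module.subspace s U"
  shows "finite_dim_quotient s U \<longleftrightarrow> (\<exists>F. finite F \<and> module.span s (U \<union> F) = UNIV)"
proof -
  interpret vector_space s by fact
  have *: "coset U ` span F = range (coset U) \<longleftrightarrow> span (U \<union> F) = UNIV" for F
  proof
    assume L: "coset U ` span F = range (coset U)"
    have "x \<in> span (U \<union> F)" for x
    proof -
      from L obtain y where y: "y \<in> span F" "coset U x = coset U y" by blast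
      then have "x - y \<in> U" using coset_eq_iff[OF assms(2)] by blast
      then have "x - y \<in> span (U \<union> F)" "y \<in> span (U \<union> F)"
        using y(1) span_mono[of F "U \<union> F"] by (auto intro: span_base)
      then have "(x - y) + y \<in> span (U \<union> F)" by (rule span_add)
      then show ?thesis by simp
    qed
    then show "span (U \<union> F) = UNIV" by auto
  next
    assume R: "span (U \<union> F) = UNIV"
    have "coset U x \<in> coset U ` span F" for x
    proof -
      have "x \<in> span (U \<union> F)" using R by simp
      then obtain u f where uf: "x = u + f" "u \<in> span U" "f \<in> span F"
        unfolding span_Un by auto
      moreover have "span U = U" using assms(2) span_eq_iff by blast
      ultimately have "x - f \<in> U" by simp
      then have "coset U x = coset U f" using coset_eq_iff[OF assms(2)] by blast
      then show ?thesis using uf by blast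
    qed
    then show "coset U ` span F = range (coset U)" by auto
  qed
  show ?thesis
  proof
    assume "finite_dim_quotient s U"
    then obtain B where B: "finite B" "B \<subseteq> range (coset U)"
        "quotient_span s U B = range (coset U)"
      unfolding finite_dim_quotient_def quotient_space_def by auto
    then obtain F where F: "finite F" "B = coset U ` F"
      using finite_subset_image[OF B(1,2)] by auto
    have "coset U ` span F = range (coset U)"
      using B(3) unfolding F(2) by (simp only: quotient_span_coset_image[OF assms])
    then have "span (U \<union> F) = UNIV" by (rule iffD1[OF *])
    with F(1) show "\<exists>F. finite F \<and> span (U \<union> F) = UNIV" by (intro exI conjI)
  next
    assume "\<exists>F. finite F \<and> span (U \<union> F) = UNIV"
    then obtain F where F: "finite F" "span (U \<union> F) = UNIV" by auto
    have "quotient_span s U (coset U ` F) = range (coset U)"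
      unfolding quotient_span_coset_image[OF assms] by (rule iffD2[OF *]) (rule F(2))
    moreover have "finite (coset U ` F)" using F(1) by simp
    moreover have "coset U ` F \<subseteq> range (coset U)" by auto
    ultimately show "finite_dim_quotient s U"
      unfolding finite_dim_quotient_def quotient_space_def
      by (intro exI[of _ "coset U ` F"] conjI)
  qed
qed


text \<open>
  A vertex operator map \<open>Y(v,x) = \<Sum>\<^sub>n v\<^sub>n x\<^bsup>-n-1\<^esup>\<close> is represented by its modes: \<open>Y v n w\<close> is \<open>v\<^sub>n w\<close>.
  The Jacobi identity is stated in modes, as obtained by comparing the coefficients of
  \<open>x\<^sub>0\<^bsup>-l-1\<^esup> x\<^sub>1\<^bsup>-m-1\<^esup> x\<^sub>2\<^bsup>-n-1\<^esup>\<close> in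
  \<open>x\<^sub>0\<^bsup>-1\<^esup>\<delta>((x\<^sub>1-x\<^sub>2)/x\<^sub>0) Y\<^sub>W(u,x\<^sub>1)Y\<^sub>W(v,x\<^sub>2) - x\<^sub>0\<^bsup>-1\<^esup>\<delta>((x\<^sub>2-x\<^sub>1)/(-x\<^sub>0)) Y\<^sub>W(v,x\<^sub>2)Y\<^sub>W(u,x\<^sub>1)
     = x\<^sub>2\<^bsup>-1\<^esup>\<delta>((x\<^sub>1-x\<^sub>0)/x\<^sub>2) Y\<^sub>W(Y(u,x\<^sub>0)v,x\<^sub>2)\<close>.
  By the truncation condition both sums have only finitely many nonzero terms, so \<open>Sum_any\<close>
  (which is \<open>0\<close> on infinite support) is the intended sum.
\<close>

definition jacobi_identity ::
  "('v \<Rightarrow> int \<Rightarrow> 'v \<Rightarrow> 'v) \<Rightarrow> (complex \<Rightarrow> 'w \<Rightarrow> 'w) \<Rightarrow> ('v \<Rightarrow> int \<Rightarrow> 'w \<Rightarrow> 'w::ab_group_add) \<Rightarrow> bool" where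
  "jacobi_identity Y sW YW \<longleftrightarrow> (\<forall>u v w. \<forall>l m n :: int.
     Sum_any (\<lambda>i::nat. sW (of_int m gchoose i) (YW (Y u (l + int i) v) (m + n - int i) w)) =
     Sum_any (\<lambda>i::nat. sW ((-1) ^ i * (of_int l gchoose i))
       (YW u (m + l - int i) (YW v (n + int i) w)
        - sW ((-1) powi l) (YW v (n + l - int i) (YW u (m + int i) w)))))"

locale vertex_algebra = vector_space sV
  for sV :: "complex \<Rightarrow> 'v::ab_group_add \<Rightarrow> 'v" +
  fixes vac :: 'v
    and Y :: "'v \<Rightarrow> int \<Rightarrow> 'v \<Rightarrow> 'v"
  assumes Y_linear_left: "Vector_Spaces.linear sV sV (\<lambda>u. Y u n v)"
    and Y_linear_right: "Vector_Spaces.linear sV sV (Y u n)"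
    and Y_truncation: "\<exists>N. \<forall>n\<ge>N. Y u n v = 0"
    and Y_vacuum: "Y vac n v = (if n = -1 then v else 0)"
    and Y_creation_nonneg: "n \<ge> 0 \<Longrightarrow> Y v n vac = 0"
    and Y_creation: "Y v (-1) vac = v"
    and Y_jacobi: "jacobi_identity Y sV Y"

locale vertex_algebra_module = vertex_algebra sV vac Y + W: vector_space sW
  for sV :: "complex \<Rightarrow> 'v::ab_group_add \<Rightarrow> 'v"
    and vac :: 'v
    and Y :: "'v \<Rightarrow> int \<Rightarrow> 'v \<Rightarrow> 'v"
    and sW :: "complex \<Rightarrow> 'w::ab_group_add \<Rightarrow> 'w" +
  fixes YW :: "'v \<Rightarrow> int \<Rightarrow> 'w \<Rightarrow> 'w"
  assumes YW_linear_left: "Vector_Spaces.linear sV sW (\<lambda>v. YW v n w)"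
    and YW_linear_right: "Vector_Spaces.linear sW sW (YW v n)"
    and YW_truncation: "\<exists>N. \<forall>n\<ge>N. YW v n w = 0"
    and YW_vacuum: "YW vac n w = (if n = -1 then w else 0)"
    and YW_jacobi: "jacobi_identity Y sW YW"

lemma (in vertex_algebra) adjoint_module: "vertex_algebra_module sV vac Y sV Y"
proof (intro vertex_algebra_module.intro vertex_algebra_module_axioms.intro)
  show "vertex_algebra sV vac Y" "vector_space sV" by intro_locales
qed (fact Y_linear_left Y_linear_right Y_truncation Y_vacuum Y_jacobi)+


definition C_subspace ::
  "(complex \<Rightarrow> 'w::ab_group_add \<Rightarrow> 'w) \<Rightarrow> ('v \<Rightarrow> int \<Rightarrow> 'w \<Rightarrow> 'w) \<Rightarrow> nat \<Rightarrow> 'w set" where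
  "C_subspace sW YW n = module.span sW {YW v (- int n) w | v w. True}"

definition C_cofinite ::
  "(complex \<Rightarrow> 'w::ab_group_add \<Rightarrow> 'w) \<Rightarrow> ('v \<Rightarrow> int \<Rightarrow> 'w \<Rightarrow> 'w) \<Rightarrow> nat \<Rightarrow> bool" where
  "C_cofinite sW YW n \<longleftrightarrow> finite_dim_quotient sW (C_subspace sW YW n)"

end

theory Submission
  imports Defs
begin

text \<open>
  Fix \<open>n \<ge> 2\<close>. In the iterate formula for \<open>(u\<^bsub>-1\<^esub> v)\<^bsub>-2n+1\<^esub> w\<close> every term other than \<open>u\<^bsub>-n\<^esub> v\<^bsub>-n\<^esub> w\<close>
  contains a mode of index at most \<open>-n-1\<close>, which the commutator formula moves to the left; hence
  \<open>u\<^bsub>-n\<^esub> v\<^bsub>-n\<^esub> w \<in> C\<^bsub>n+1\<^esub>(W)\<close>. The iterate formula for \<open>(a\<^bsub>-n\<^esub> b)\<^bsub>-n\<^esub> w\<close> then places this vector in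
  \<open>C\<^bsub>n+1\<^esub>(W)\<close> as well. So modulo \<open>C\<^bsub>n+1\<^esub>(W)\<close> the map \<open>(u, w) \<mapsto> u\<^bsub>-n\<^esub> w\<close> factors through
  \<open>V/C\<^sub>n(V) \<times> W/C\<^sub>n(W)\<close>, and cofiniteness passes from \<open>n\<close> to \<open>n + 1\<close>, first for \<open>V\<close> and then for \<open>W\<close>.
\<close>

text \<open>On infinite support \<open>Sum_any\<close> is \<open>0\<close>, which also lies in
  \<open>S\<close>.\<close>

lemma (in module) subspace_Sum_any:
  assumes "subspace S" "\<And>i. f i \<in> S"
  shows "Sum_any f \<in> S"
  unfolding Sum_any.expand_set by (rule subspace_sum[OF assms(1)]) (use assms(2) in blast)

lemma Sum_any_remove:
  fixes f :: "'b \<Rightarrow> 'a::ab_group_add"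
  assumes "finite {i. f i \<noteq> 0}"
  shows "Sum_any f = f k + Sum_any (\<lambda>i. if i = k then 0 else f i)"
proof -
  have "Sum_any f = Sum_any (\<lambda>i. (if i = k then f k else 0) + (if i = k then 0 else f i))"
    by (rule arg_cong[of _ _ Sum_any]) auto
  also have "\<dots> = f k + Sum_any (\<lambda>i. if i = k then 0 else f i)"
    by (subst Sum_any.distrib) (auto intro: finite_subset[OF _ assms])
  finally show ?thesis .
qed

lemma gbinomial_0_left: "(0 :: 'a::field_char_0) gchoose i = (if i = 0 then 1 else 0)"
  by (cases i) auto

lemma minus_one_power_mult_gbinomial: "(- 1) ^ i * (- 1 gchoose i) = (1::complex)"
  by (simp add: gbinomial_minus binomial_gbinomial[symmetric] flip: power_mult_distrib)

context vertex_algebra_module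
begin

abbreviation C :: "nat \<Rightarrow> 'w set" where
  "C \<equiv> C_subspace sW YW"

lemma YW_zero_right [simp]: "YW v n 0 = 0"
  using module_hom.zero[OF YW_linear_right[THEN Vector_Spaces.linear.axioms(3)]] .

lemma subspace_C: "W.subspace (C N)"
  unfolding C_subspace_def by (rule W.subspace_span)

lemma mode_in_C: "YW v (- int N) w \<in> C N"
  unfolding C_subspace_def by (rule W.span_base) blast

text \<open>The Jacobi identity at \<open>m = 0\<close>, where \<open>0 gchoose i\<close> leaves a
  single term on the left.\<close>

lemma iterate_formula:
  "YW (Y u l v) n w =
     Sum_any (\<lambda>i::nat. sW ((-1) ^ i * (of_int l gchoose i))
       (YW u (l - int i) (YW v (n + int i) w)
        - sW ((-1) powi l) (YW v (n + l - int i) (YW u (int i) w))))"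
proof -
  have "Sum_any (\<lambda>i::nat. sW (of_int 0 gchoose i) (YW (Y u (l + int i) v) (n - int i) w))
      = Sum_any (\<lambda>i::nat. if i = 0 then YW (Y u l v) n w else 0)"
    by (rule arg_cong[of _ _ Sum_any]) (auto simp: gbinomial_0_left)
  then show ?thesis
    using YW_jacobi[unfolded jacobi_identity_def, rule_format,
        where u = u and v = v and w = w and l = l and m = 0 and n = n] by simp
qed

text \<open>The Jacobi identity at \<open>l = 0\<close>, where the right side collapses
  instead.\<close>

lemma commutator_formula:
  "YW u m (YW v n w) - YW v n (YW u m w) =
     Sum_any (\<lambda>i::nat. sW (of_int m gchoose i) (YW (Y u (int i) v) (m + n - int i) w))"
proof -
  have "Sum_any (\<lambda>i::nat. sW ((-1) ^ i * (of_int 0 gchoose i))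
       (YW u (m - int i) (YW v (n + int i) w) - YW v (n - int i) (YW u (m + int i) w)))
      = Sum_any (\<lambda>i::nat. if i = 0 then YW u m (YW v n w) - YW v n (YW u m w) else 0)"
    by (rule arg_cong[of _ _ Sum_any]) (auto simp: gbinomial_0_left)
  then show ?thesis
    using YW_jacobi[unfolded jacobi_identity_def, rule_format,
        where u = u and v = v and w = w and l = 0 and m = m and n = n] by simp
qed

text \<open>\<open>Y u (-2) vac\<close> is the image of \<open>u\<close> under the canonical derivation of \<open>V\<close>.\<close>

lemma derivative_mode:
  assumes "k \<ge> 1"
  shows "YW (Y u (-2) vac) (- int k) w = sW (of_nat k) (YW u (- int k - 1) w)"
proof -
  have coeff: "(-1) ^ i * ((-2::complex) gchoose i) = of_nat (Suc i)" for i
    using binomial_gbinomial[of "Suc i" i, where 'a = complex]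
    by (simp add: gbinomial_minus flip: power_mult_distrib)
  have "YW (Y u (-2) vac) (- int k) w =
     Sum_any (\<lambda>i. if i = k - 1 then sW (of_nat k) (YW u (- int k - 1) w) else 0)"
    unfolding iterate_formula
  proof (rule arg_cong[of _ _ Sum_any], rule ext)
    fix i
    \<comment> \<open>The vacuum has only the mode \<open>-1\<close>. This selects one
      \<open>i\<close> in the first term; the index in the second term is at most \<open>-3\<close>,
      so that term vanishes.\<close>
    have "- int k + int i = -1 \<longleftrightarrow> i = k - 1" using assms by auto
    moreover have "-2 - int i = - int k - 1" "Suc i = k" if "i = k - 1" using assms that by auto
    ultimately show "sW ((-1) ^ i * (of_int (-2) gchoose i))
        (YW u (-2 - int i) (YW vac (- int k + int i) w)
         - sW ((-1) powi -2) (YW vac (- int k + -2 - int i) (YW u (int i) w)))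
      = (if i = k - 1 then sW (of_nat k) (YW u (- int k - 1) w) else 0)"
      using coeff[of i] by (cases "i = k - 1") (simp_all add: YW_vacuum minus_diff_commute)
  qed
  then show ?thesis by simp
qed

text \<open>Passing from \<open>v\<close> to its derivative lowers the index by one at the cost of
  the nonzero factor \<open>N + d\<close>, so the induction must let \<open>v\<close> vary.\<close>

lemma mode_in_C_le:
  assumes "1 \<le> N" "k \<le> - int N"
  shows "YW v k w \<in> C N"
proof -
  have "YW v (- int (N + d)) w \<in> C N" for d
  proof (induction d arbitrary: v)
    case 0
    show ?case using mode_in_C[of v N w] by simp
  next
    case (Suc d)
    let ?k = "N + d"
    have "sW (inverse (of_nat ?k)) (YW (Y v (-2) vac) (- int ?k) w) \<in> C N"
      by (intro W.subspace_scale subspace_C Suc)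
    also have "sW (inverse (of_nat ?k)) (YW (Y v (-2) vac) (- int ?k) w) = YW v (- int ?k - 1) w"
      unfolding derivative_mode[OF trans_le_add1[OF assms(1)]] using assms(1)
      by (simp add: W.scale_scale del: of_nat_add)
    finally show ?case
      by (metis add_Suc_right diff_minus_eq_add minus_add_distrib of_nat_Suc
          add.commute uminus_add_conv_diff)
  qed
  from this[of "nat (- k) - N"] show ?thesis using assms by simp
qed

text \<open>Every term of the commutator formula is one mode of index
  \<open>m + n - i\<close>.\<close>

lemma commutator_in_C:
  assumes "1 \<le> N" "m + n \<le> - int N"
  shows "YW u m (YW v n w) - YW v n (YW u m w) \<in> C N"
  unfolding commutator_formula
  by (intro W.subspace_Sum_any W.subspace_scale subspace_C mode_in_C_le) (use assms in auto)

lemma right_mode_in_C: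
  assumes "1 \<le> N" "n \<le> - int N" "m + n \<le> - int N"
  shows "YW u m (YW v n w) \<in> C N"
  using W.subspace_add[OF subspace_C commutator_in_C[OF assms(1,3), of u v w]
      mode_in_C_le[OF assms(1,2), of v "YW u m w"]] by simp

lemma product_in_C:
  assumes "n \<ge> 2"
  shows "YW u (- int n) (YW v (- int n) w) \<in> C (Suc n)"
proof -
  \<comment> \<open>The summand at \<open>l = -1\<close>: all coefficients are \<open>1\<close>, and
    the sign \<open>(-1) powi -1\<close> turns the difference into a sum.\<close>
  define f where "f = (\<lambda>i::nat. YW u (-1 - int i) (YW v (1 - 2 * int n + int i) w)
       + YW v (- 2 * int n - int i) (YW u (int i) w))"
  have iter: "YW (Y u (-1) v) (1 - 2 * int n) w = Sum_any f"
    unfolding iterate_formula f_def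
    by (simp add: minus_one_power_mult_gbinomial)
  obtain M N where M: "\<And>k. k \<ge> M \<Longrightarrow> YW u k w = 0" and N: "\<And>k. k \<ge> N \<Longrightarrow> YW v k w = 0"
    using YW_truncation by metis
  have "{i. f i \<noteq> 0} \<subseteq> {..nat (max M (N + 2 * int n))}"
  proof
    fix i assume "i \<in> {i. f i \<noteq> 0}"
    then have "\<not> (int i \<ge> M \<and> 1 - 2 * int n + int i \<ge> N)"
      unfolding f_def using M[of "int i"] N[of "1 - 2 * int n + int i"] by auto
    then show "i \<in> {..nat (max M (N + 2 * int n))}" by auto
  qed
  then have fin: "finite {i. f i \<noteq> 0}" by (rule finite_subset) simp
  \<comment> \<open>At \<open>i = n - 1\<close> both modes of the first product have index
    \<open>-n\<close>. For larger \<open>i\<close> the outer index is below \<open>-n\<close>, for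
    smaller \<open>i\<close> the inner one is.\<close>
  have rest: "f i \<in> C (Suc n)" if "i \<noteq> n - 1" for i
  proof -
    have "YW u (-1 - int i) (YW v (1 - 2 * int n + int i) w) \<in> C (Suc n)"
    proof (cases "i \<ge> n")
      case True
      then show ?thesis by (intro mode_in_C_le) auto
    next
      case False
      then show ?thesis using that assms by (intro right_mode_in_C) auto
    qed
    moreover have "YW v (- 2 * int n - int i) (YW u (int i) w) \<in> C (Suc n)"
      using assms by (intro mode_in_C_le) auto
    ultimately show ?thesis unfolding f_def by (rule W.subspace_add[OF subspace_C])
  qed
  \<comment> \<open>Here \<open>1 - 2n \<le> -(n + 1)\<close> is exactly
    \<open>n \<ge> 2\<close>.\<close>
  have "Sum_any f \<in> C (Suc n)"
    unfolding iter[symmetric] using assms by (intro mode_in_C_le) auto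
  moreover have "Sum_any (\<lambda>i. if i = n - 1 then 0 else f i) \<in> C (Suc n)"
    by (rule W.subspace_Sum_any[OF subspace_C]) (auto simp: rest W.subspace_0[OF subspace_C])
  ultimately have "f (n - 1) \<in> C (Suc n)"
    using Sum_any_remove[OF fin, of "n - 1"] W.subspace_diff[OF subspace_C]
    by (metis add_diff_cancel_right')
  moreover have "YW v (- 2 * int n - int (n - 1)) (YW u (int (n - 1)) w) \<in> C (Suc n)"
    using assms by (intro mode_in_C_le) auto
  moreover have "f (n - 1) = YW u (- int n) (YW v (- int n) w)
      + YW v (- 2 * int n - int (n - 1)) (YW u (int (n - 1)) w)"
    using assms by (simp add: f_def of_nat_diff)
  ultimately show ?thesis
    using W.subspace_diff[OF subspace_C] by (metis add_diff_cancel_right')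
qed

text \<open>Only the term \<open>i = 0\<close> of the first family needs
  \<open>product_in_C\<close>; all other outer indices are at most \<open>-n-1\<close>.\<close>

lemma iterate_in_C:
  assumes "n \<ge> 2"
  shows "YW (Y u (- int n) v) (- int n) w \<in> C (Suc n)"
proof -
  have "YW u (- int n - int i) (YW v (- int n + int i) w) \<in> C (Suc n)" for i
    using product_in_C[OF assms] by (cases "i = 0") (auto intro!: mode_in_C_le)
  moreover have "YW v (- int n + - int n - int i) (YW u (int i) w) \<in> C (Suc n)" for i
    using assms by (intro mode_in_C_le) auto
  ultimately show ?thesis
    unfolding iterate_formula
    by (intro W.subspace_Sum_any W.subspace_scale W.subspace_diff subspace_C)
qed

lemma C_cofinite_iff:
  "C_cofinite sW YW n \<longleftrightarrow> (\<exists>F. finite F \<and> W.span (C n \<union> F) = UNIV)"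
  unfolding C_cofinite_def by (rule finite_dim_quotient_iff[OF W.vector_space_axioms subspace_C])

lemma C_cofinite_Suc:
  assumes "n \<ge> 2" "C_cofinite sV Y n" "C_cofinite sW YW n"
  shows "C_cofinite sW YW (Suc n)"
proof -
  interpret V: vertex_algebra_module sV vac Y sV Y by (rule adjoint_module)
  obtain G where G: "finite G" "span (V.C n \<union> G) = UNIV"
    using assms(2) V.C_cofinite_iff by auto
  obtain F where F: "finite F" "W.span (C n \<union> F) = UNIV"
    using assms(3) C_cofinite_iff by auto
  \<comment> \<open>The added products will span \<open>C n\<close> modulo
    \<open>C (Suc n)\<close>.\<close>
  define F' where "F' = F \<union> (\<lambda>(g, f). YW g (- int n) f) ` (G \<times> F)"
  define S where "S = W.span (C (Suc n) \<union> F')"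
  have S: "W.subspace S" unfolding S_def by (rule W.subspace_span)
  have C_S: "x \<in> S" if "x \<in> C (Suc n)" for x
    unfolding S_def using that by (auto intro: W.span_base)
  have linear_YW: "module_hom sV sW (\<lambda>u. YW u (- int n) w)" "module_hom sW sW (YW u (- int n))"
    for u w
    using YW_linear_left YW_linear_right by (simp_all add: Vector_Spaces.linear.axioms(3))
  \<comment> \<open>Reduces the left argument to \<open>G\<close>, with \<open>iterate_in_C\<close>
    absorbing \<open>V.C n\<close>.\<close>
  have u_F: "YW u (- int n) f \<in> S" if "f \<in> F" for u f
  proof -
    have "subspace {u. YW u (- int n) f \<in> S}"
      using module_hom.subspace_vimage[OF linear_YW(1) S] by (simp add: vimage_def)
    moreover have "YW g (- int n) f \<in> S" if "g \<in> G" for g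
      unfolding S_def F'_def using that \<open>f \<in> F\<close> by (intro W.span_base) auto
    moreover from calculation(1) have "V.C n \<subseteq> {u. YW u (- int n) f \<in> S}"
      unfolding C_subspace_def
      by (intro span_minimal) (auto intro: C_S iterate_in_C[OF assms(1)])
    ultimately have "span (V.C n \<union> G) \<subseteq> {u. YW u (- int n) f \<in> S}"
      by (intro span_minimal) auto
    then show ?thesis using G(2) by auto
  qed
  \<comment> \<open>Reduces the right argument to \<open>F\<close>, with \<open>product_in_C\<close>
    absorbing \<open>C n\<close>.\<close>
  have u_w: "YW u (- int n) w \<in> S" for u w
  proof -
    have "W.subspace {w. YW u (- int n) w \<in> S}"
      using module_hom.subspace_vimage[OF linear_YW(2) S] by (simp add: vimage_def)
    moreover from this have "C n \<subseteq> {w. YW u (- int n) w \<in> S}"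
      unfolding C_subspace_def
      by (intro W.span_minimal) (auto intro: C_S product_in_C[OF assms(1)])
    ultimately have "W.span (C n \<union> F) \<subseteq> {w. YW u (- int n) w \<in> S}"
      by (intro W.span_minimal) (auto intro: u_F)
    then show ?thesis using F(2) by auto
  qed
  have "C n \<subseteq> S"
    unfolding C_subspace_def by (intro W.span_minimal S) (auto intro: u_w)
  moreover have "F \<subseteq> S" unfolding S_def F'_def by (auto intro: W.span_base)
  ultimately have "W.span (C n \<union> F) \<subseteq> S" by (intro W.span_minimal S) auto
  then have "S = UNIV" using F(2) by auto
  moreover have "finite F'" unfolding F'_def using F(1) G(1) by simp
  ultimately show ?thesis unfolding C_cofinite_iff S_def by blast
qed

end

theorem proposition4p5:
  fixes sV :: "complex \<Rightarrow> 'v::ab_group_add \<Rightarrow> 'v"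
    and vac :: 'v
    and Y :: "'v \<Rightarrow> int \<Rightarrow> 'v \<Rightarrow> 'v"
    and sW :: "complex \<Rightarrow> 'w::ab_group_add \<Rightarrow> 'w"
    and YW :: "'v \<Rightarrow> int \<Rightarrow> 'w \<Rightarrow> 'w"
  assumes "vertex_algebra sV vac Y"
    and "vertex_algebra_module sV vac Y sW YW"
    and "C_cofinite sV Y 2"
    and "C_cofinite sW YW 2"
  shows "\<forall>n\<ge>2. C_cofinite sW YW n"
proof (intro allI impI)
  interpret V: vertex_algebra_module sV vac Y sV Y
    by (rule vertex_algebra.adjoint_module[OF assms(1)])
  interpret W: vertex_algebra_module sV vac Y sW YW by (rule assms(2))
  fix n :: nat assume "n \<ge> 2"
  \<comment> \<open>The step for \<open>W\<close> uses cofiniteness of \<open>V\<close> at the same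
    level, so both are carried along; \<open>V\<close> is treated as its own adjoint module.\<close>
  then have "C_cofinite sV Y n \<and> C_cofinite sW YW n"
    by (induction n rule: dec_induct) (auto simp: assms(3,4) intro: V.C_cofinite_Suc W.C_cofinite_Suc)
  then show "C_cofinite sW YW n" ..
qed

end
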